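(* For any rational number $t > 1/2$, every minimally $t$-tough graph contains either an induced $4$-cycle or an induced $5$-cycle or a pair of independent edges as an induced subgraph (i.e., an induced $C_4$, $C_5$, or $2K_2$).
   Context: All graphs are finite, simple and undirected. $\omega(H)$ denotes the number of connected components of a graph $H$. For a real number $t$, a graph $G$ is $t$-tough if $|S| \ge t\cdot\omega(G-S)$ for every $S \subseteq V(G)$ with $\omega(G-S) > 1$. The toughness $\tau(G)$ is the largest $t$ for which $G$ is $t$-tough, where $\tau(K_n)=\infty$ for all $n\ge 1$. A graph $G$ is minimally $t$-tough if $\tau(G)=t$ and $\tau(G-e)<t$ for every $e\in E(G)$. The alternatives in the claim are not meant to be mutually exclusive. $2K_2$ is the graph consisting of two disjoint edges on four vertices. *)

theory Defs
  imports Complex_Main "HOL-Library.Extended_Real"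
begin

type_synonym 'a graph = "'a set \<times> 'a set set"

abbreviation verts :: "'a graph \<Rightarrow> 'a set" where
  "verts G \<equiv> fst G"

abbreviation edges :: "'a graph \<Rightarrow> 'a set set" where
  "edges G \<equiv> snd G"

text \<open>Edges are two-element vertex sets, so there are no loops and no multiple edges.\<close>

definition simple_graph :: "'a graph \<Rightarrow> bool" where
  "simple_graph G \<longleftrightarrow> finite (verts G) \<and> (\<forall>e\<in>edges G. e \<subseteq> verts G \<and> card e = 2)"

definition adj :: "'a graph \<Rightarrow> 'a \<Rightarrow> 'a \<Rightarrow> bool" where
  "adj G x y \<longleftrightarrow> {x, y} \<in> edges G"

definition complete_graph :: "'a graph \<Rightarrow> bool" where
  "complete_graph G \<longleftrightarrow> (\<forall>x\<in>verts G. \<forall>y\<in>verts G. x \<noteq> y \<longrightarrow> adj G x y)"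

definition delete_verts :: "'a graph \<Rightarrow> 'a set \<Rightarrow> 'a graph" where
  "delete_verts G S = (verts G - S, {e \<in> edges G. e \<inter> S = {}})"

definition delete_edge :: "'a graph \<Rightarrow> 'a set \<Rightarrow> 'a graph" where
  "delete_edge G e = (verts G, edges G - {e})"

definition connected_rel :: "'a graph \<Rightarrow> ('a \<times> 'a) set" where
  "connected_rel G = {(x, y). x \<in> verts G \<and> y \<in> verts G \<and> (adj G)\<^sup>*\<^sup>* x y}"

definition graph_components :: "'a graph \<Rightarrow> 'a set set" where
  "graph_components G = verts G // connected_rel G"

definition num_components :: "'a graph \<Rightarrow> nat" where
  "num_components G = card (graph_components G)"

definition tough :: "'a graph \<Rightarrow> real \<Rightarrow> bool" where
  "tough G t \<longleftrightarrow> (\<forall>S \<subseteq> verts G. num_components (delete_verts G S) > 1 \<longrightarrow>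
     real (card S) \<ge> t * real (num_components (delete_verts G S)))"

text \<open>A complete graph is \<open>t\<close>-tough for every \<open>t\<close>. For every other finite simple graph the
  maximum exists; see \<open>tough_Greatest\<close> below. The graph without vertices counts as complete here.\<close>

definition toughness :: "'a graph \<Rightarrow> ereal" where
  "toughness G = (if complete_graph G then \<infinity> else ereal (GREATEST t. tough G t))"

definition minimally_tough :: "'a graph \<Rightarrow> real \<Rightarrow> bool" where
  "minimally_tough G t \<longleftrightarrow>
     toughness G = ereal t \<and> (\<forall>e\<in>edges G. toughness (delete_edge G e) < ereal t)"

definition contains_induced :: "'a graph \<Rightarrow> 'b graph \<Rightarrow> bool" where
  "contains_induced G H \<longleftrightarrow> (\<exists>f. inj_on f (verts H) \<and> f ` verts H \<subseteq> verts G \<and>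
     (\<forall>x\<in>verts H. \<forall>y\<in>verts H. adj H x y \<longleftrightarrow> adj G (f x) (f y)))"

text \<open>This is the cycle on \<open>n\<close> vertices only for \<open>n \<ge> 3\<close>.\<close>

definition cycle_graph :: "nat \<Rightarrow> nat graph" where
  "cycle_graph n = ({..<n}, {{i, Suc i mod n} | i. i < n})"

definition two_K2 :: "nat graph" where
  "two_K2 = ({0, 1, 2, 3}, {{0, 1}, {2, 3}})"

lemma simple_graph_cycle_graph: "n \<ge> 3 \<Longrightarrow> simple_graph (cycle_graph n)"
  by (auto simp: simple_graph_def cycle_graph_def card_insert_if mod_Suc)

lemma simple_graph_two_K2: "simple_graph two_K2"
  by (auto simp: simple_graph_def two_K2_def)

lemma separating_set_exists:
  assumes G: "simple_graph G" and nc: "\<not> complete_graph G"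
  shows "\<exists>S \<subseteq> verts G. num_components (delete_verts G S) > 1"
proof -
  obtain u v where uv: "u \<in> verts G" "v \<in> verts G" "u \<noteq> v" "{u, v} \<notin> edges G"
    using nc by (auto simp: complete_graph_def adj_def)
  define D where "D = delete_verts G (verts G - {u, v})"
  have V: "verts D = {u, v}"
    using uv by (auto simp: D_def delete_verts_def)
  have E: "edges D = {}"
  proof -
    have False if "e \<in> edges G" "e \<inter> (verts G - {u, v}) = {}" for e
    proof -
      have "e \<subseteq> {u, v}" "card e = 2"
        using G that by (auto simp: simple_graph_def)
      moreover have "card {u, v} = 2" using uv by simp
      ultimately have "e = {u, v}" by (intro card_subset_eq) auto
      with that uv show False by simp
    qed
    then show ?thesis by (auto simp: D_def delete_verts_def)
  qed
  have "(adj D)\<^sup>*\<^sup>* x y \<longleftrightarrow> x = y" for x y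
    using E by (auto simp: adj_def elim: converse_rtranclpE)
  then have "connected_rel D = {(u, u), (v, v)}"
    by (auto simp: connected_rel_def V)
  then have "graph_components D = {{u}, {v}}"
    using uv by (auto simp: graph_components_def V quotient_def)
  then have "num_components D = 2"
    using uv by (simp add: num_components_def)
  then show ?thesis
    by (intro exI[of _ "verts G - {u, v}"]) (auto simp: D_def)
qed

lemma tough_Greatest:
  assumes G: "simple_graph G" and nc: "\<not> complete_graph G"
  shows "tough G (GREATEST t. tough G t)"
    and "tough G t \<Longrightarrow> t \<le> (GREATEST t. tough G t)"
proof -
  define W where "W = {S. S \<subseteq> verts G \<and> num_components (delete_verts G S) > 1}"
  define r where "r S = real (card S) / real (num_components (delete_verts G S))" for S
  have fin: "finite (r ` W)"
    using G by (auto simp: W_def simple_graph_def)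
  have ne: "r ` W \<noteq> {}"
    using separating_set_exists[OF G nc] by (auto simp: W_def)
  have "tough G t \<longleftrightarrow> (\<forall>S\<in>W. t \<le> r S)" for t
    by (auto simp: tough_def W_def r_def field_simps)
  then have iff: "tough G t \<longleftrightarrow> t \<le> Min (r ` W)" for t
    using fin ne by simp
  then have eq: "(GREATEST t. tough G t) = Min (r ` W)"
    by (intro Greatest_equality) auto
  show "tough G (GREATEST t. tough G t)" unfolding eq by (simp add: iff)
  show "tough G t \<Longrightarrow> t \<le> (GREATEST t. tough G t)" unfolding eq by (simp add: iff)
qed

end

theory Submission
  imports Defs
begin

text \<open>
  Graphs without induced \<open>C\<^sub>4\<close>, \<open>C\<^sub>5\<close> and \<open>2K\<^sub>2\<close> are split graphs (Foeldes and Hammer), so let the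
  vertices be partitioned into a clique \<open>C\<close> and an independent set \<open>I\<close>, where every vertex of \<open>C\<close>
  has a neighbour in \<open>I\<close>, and write \<open>N u\<close> for the neighbourhood of \<open>u\<close> in \<open>I\<close>. Deleting \<open>C\<close>, or the
  neighbourhood of some \<open>x \<in> I\<close>, shows \<open>t |I| \<le> |C|\<close> and that \<open>x\<close> has degree at least \<open>2t > 1\<close>.
  If removing an edge \<open>uv\<close> of \<open>C\<close> lowers the toughness, then \<open>uv\<close> is a bridge after deleting the
  witness set, which therefore contains the rest of \<open>C\<close> and all common neighbours of \<open>u\<close> and \<open>v\<close>, so
  \<open>|C| - 2 + |N u \<inter> N v| < t (2 + |I| - |N u \<union> N v|)\<close>. Hence the vertices of \<open>C\<close> have few neighbours
  in \<open>I\<close>, and counting the edges between \<open>C\<close> and \<open>I\<close> gives a contradiction.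
\<close>

section \<open>Counting edges between a clique and an independent set\<close>

lemma sum_card_incidence:
  assumes "finite C" "finite I" "\<And>u. u \<in> C \<Longrightarrow> N u \<subseteq> I"
  shows "(\<Sum>u\<in>C. card (N u)) = (\<Sum>x\<in>I. card {u \<in> C. x \<in> N u})"
proof -
  have "N u = {x \<in> I. x \<in> N u}" if "u \<in> C" for u
    using assms(3)[OF that] by auto
  then have "(\<Sum>u\<in>C. card (N u)) = (\<Sum>u\<in>C. \<Sum>x\<in>{x \<in> I. x \<in> N u}. 1)"
    by (intro sum.cong) auto
  also have "\<dots> = (\<Sum>x\<in>I. \<Sum>u\<in>{u \<in> C. x \<in> N u}. 1)"
    by (rule sum.swap_restrict[OF assms(1,2)])
  finally show ?thesis by simp
qed

lemma card_ge_2_minus_nonempty: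
  assumes "card C \<ge> 2"
  shows "C - {u} \<noteq> {}"
proof
  assume "C - {u} = {}"
  then have "C = {} \<or> C = {u}" by auto
  then show False using assms by auto
qed

text \<open>Add the bound over all ordered pairs of distinct elements: with
  \<open>n = card C\<close>, each \<open>f u\<close> is counted \<open>2 * (n - 1)\<close> times,
  and the positive factor \<open>n - 1\<close> cancels.\<close>

lemma sum_pairs_bound:
  fixes f :: "'a \<Rightarrow> real" and B :: real
  assumes fin: "finite C" and two: "card C \<ge> 2"
    and b: "\<And>u v. u \<in> C \<Longrightarrow> v \<in> C \<Longrightarrow> u \<noteq> v \<Longrightarrow> f u + f v < B"
  shows "2 * sum f C < card C * B"
proof -
  let ?n = "real (card C)"
  have ne: "C - {u} \<noteq> {}" if "u \<in> C" for u
    using card_ge_2_minus_nonempty[OF two] .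
  have "(\<Sum>u\<in>C. \<Sum>v\<in>C - {u}. f u + f v) < (\<Sum>u\<in>C. \<Sum>v\<in>C - {u}. B)"
    using fin two ne b by (intro sum_strict_mono) auto
  also have "\<dots> = (?n - 1) * (?n * B)"
    using fin two by (simp add: of_nat_diff)
  finally have "(\<Sum>u\<in>C. \<Sum>v\<in>C - {u}. f u + f v) < (?n - 1) * (?n * B)" .
  moreover have "(\<Sum>u\<in>C. \<Sum>v\<in>C - {u}. f u + f v) = (\<Sum>u\<in>C. (?n - 2) * f u + sum f C)"
    using fin two by (intro sum.cong refl) (simp add: sum.distrib sum_diff1 of_nat_diff algebra_simps)
  moreover have "\<dots> = (?n - 2) * sum f C + ?n * sum f C"
    by (simp add: sum.distrib flip: sum_distrib_left)
  ultimately have "(?n - 1) * (2 * sum f C) < (?n - 1) * (?n * B)"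
    by (simp add: algebra_simps)
  then show ?thesis using two by (simp add: mult_less_cancel_left)
qed

text \<open>The purely numerical core, with \<open>C\<close> the clique and \<open>N u\<close> the
  neighbours of \<open>u\<close> in \<open>I\<close>. Bounding the incidences from above through
  \<open>pair\<close> and from below through \<open>deg\<close> conflicts in each of three ranges:
  \<open>t > 1\<close>; \<open>t \<le> 1\<close> with at least four clique vertices;
  \<open>t \<le> 1\<close> with at most three.\<close>

lemma split_counting:
  fixes N :: "'a \<Rightarrow> 'b set" and t :: real
  assumes finC: "finite C" and finI: "finite I"
    and sub: "\<And>u. u \<in> C \<Longrightarrow> N u \<subseteq> I" and ne: "\<And>u. u \<in> C \<Longrightarrow> N u \<noteq> {}"
    and two: "card I \<ge> 2" and t: "t > 1 / 2"
    and tI: "t * card I \<le> card C"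
    and deg: "\<And>x. x \<in> I \<Longrightarrow> 2 * t \<le> card {u \<in> C. x \<in> N u}"
    and pair: "\<And>u v. u \<in> C \<Longrightarrow> v \<in> C \<Longrightarrow> u \<noteq> v \<Longrightarrow>
      real (card C) - 2 + card (N u \<inter> N v) < t * (2 + real (card I) - card (N u \<union> N v))"
  shows False
proof -
  define n where "n = card C"
  define m where "m = card I"
  have finN: "finite (N u)" if "u \<in> C" for u
    using sub[OF that] finI finite_subset by blast
  have dpos: "card (N u) \<ge> 1" if "u \<in> C" for u
    using finN[OF that] ne[OF that] by (simp add: Suc_le_eq card_gt_0_iff)
  have D: "card (N u) + card (N v) = card (N u \<union> N v) + card (N u \<inter> N v)"
    if "u \<in> C" "v \<in> C" for u v
    using finN that by (intro card_Un_Int) auto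
  \<comment> \<open>The degree is an integer and at least \<open>2 * t > 1\<close>.\<close>
  have deg2: "card {u \<in> C. x \<in> N u} \<ge> 2" if "x \<in> I" for x
    using deg[OF that] t by linarith
  obtain x where x: "x \<in> I" using two by fastforce
  have "card {u \<in> C. x \<in> N u} \<le> n"
    unfolding n_def using finC by (intro card_mono) auto
  then have n2: "n \<ge> 2" using deg2[OF x] by simp
  show False
  proof (cases "t > 1")
    case True
    \<comment> \<open>With \<open>a\<close> and \<open>c\<close> the sizes of union and
      intersection, \<open>pair\<close> and \<open>tI\<close> give
      \<open>c + t * a < 2 * t + 2\<close>. If \<open>a + c \<ge> 4\<close>, then
      \<open>a \<ge> 2\<close>, and \<open>c + t * a = (a + c) + (t - 1) * a\<close> is at least
      \<open>2 * t + 2\<close>.\<close>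
    have D3: "card (N u) + card (N v) \<le> 3" if "u \<in> C" "v \<in> C" "u \<noteq> v" for u v
    proof (rule ccontr)
      let ?a = "card (N u \<union> N v)" and ?c = "card (N u \<inter> N v)"
      assume "\<not> ?thesis"
      then have ac: "?a + ?c \<ge> 4" using D that by simp
      have "?c \<le> ?a" using finN that by (intro card_mono) auto
      then have "?a \<ge> 2" using ac by simp
      then have "(t - 1) * real ?a \<ge> (t - 1) * 2" using True by (intro mult_left_mono) auto
      moreover have "real ?a + real ?c \<ge> 4" using ac by linarith
      moreover have "?c + t * ?a < 2 * t + 2"
        using pair[OF that] tI by (simp add: algebra_simps)
      ultimately show False by (simp add: algebra_simps)
    qed
    \<comment> \<open>By \<open>D3\<close> and \<open>dpos\<close> at most one vertex of
      \<open>C\<close> has more than one neighbour in \<open>I\<close>, and that one has exactly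
      two.\<close>
    have sumd: "(\<Sum>u\<in>C. card (N u)) \<le> n + 1"
    proof (cases "\<exists>u\<in>C. card (N u) \<ge> 2")
      case False
      then have "(\<Sum>u\<in>C. card (N u)) \<le> (\<Sum>u\<in>C. 1)" by (intro sum_mono) force
      then show ?thesis by (simp add: n_def)
    next
      case True
      then obtain u where u: "u \<in> C" "card (N u) \<ge> 2" by auto
      have o: "card (N v) \<le> 1" if "v \<in> C - {u}" for v
        using D3[of u v] u that by auto
      obtain v where v: "v \<in> C - {u}"
        using card_ge_2_minus_nonempty[of C u] n2 by (auto simp: n_def)
      have "card (N u) \<le> 2" using D3[of u v] dpos[of v] u v by auto
      moreover have "(\<Sum>v\<in>C - {u}. card (N v)) \<le> (\<Sum>v\<in>C - {u}. 1)"
        using o by (intro sum_mono) auto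
      moreover have "(\<Sum>u\<in>C. card (N u)) = card (N u) + (\<Sum>v\<in>C - {u}. card (N v))"
        using finC u by (simp add: sum.remove)
      ultimately show ?thesis using u finC n2 by (simp add: n_def)
    qed
    have deg3: "card {u \<in> C. x \<in> N u} \<ge> 3" if "x \<in> I" for x
      using deg[OF that] True by linarith
    have "(\<Sum>x\<in>I. 3) \<le> (\<Sum>x\<in>I. card {u \<in> C. x \<in> N u})"
      using deg3 by (intro sum_mono) auto
    then have m3: "3 * m \<le> n + 1"
      using sumd sum_card_incidence[OF finC finI sub] by (simp add: m_def mult.commute)
    have "(\<Sum>x\<in>I. 2 * t) \<le> (\<Sum>x\<in>I. real (card {u \<in> C. x \<in> N u}))"
      using deg by (intro sum_mono) auto
    also have "\<dots> = real (\<Sum>u\<in>C. card (N u))"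
      using sum_card_incidence[OF finC finI sub] by simp
    also have "\<dots> \<le> real (n + 1)" using sumd by (rule of_nat_mono)
    finally have tm: "2 * (t * m) \<le> n + 1" by (simp add: m_def algebra_simps)
    \<comment> \<open>For such a pair the right side of \<open>pair\<close> is at most
      \<open>t * m\<close>, so \<open>n < t * m + 2\<close>. Together with \<open>tm\<close> this
      forces \<open>n \<le> 4\<close>, and \<open>m3\<close> then leaves
      \<open>m \<le> 1\<close>.\<close>
    obtain u v where uv: "u \<in> C" "v \<in> C" "u \<noteq> v" "card (N u \<union> N v) \<ge> 2"
    proof -
      obtain y where y: "y \<in> I" "y \<noteq> x"
        using two x finI by (metis card_le_Suc0_iff_eq not_less_eq_eq numeral_2_eq_2)
      have nb: "\<exists>u\<in>C. z \<in> N u" if "z \<in> I" for z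
        using card_ge_2_minus_nonempty[OF deg2[OF that]] by blast
      obtain u where u: "u \<in> C" "x \<in> N u" using nb x by blast
      obtain v0 where v0: "v0 \<in> C" "y \<in> N v0" using nb y by blast
      obtain w where w: "w \<in> C - {u}"
        using card_ge_2_minus_nonempty[of C u] n2 by (auto simp: n_def)
      \<comment> \<open>If one clique vertex sees both \<open>x\<close> and \<open>y\<close>, any
        second vertex completes the pair.\<close>
      define v where "v = (if v0 = u then w else v0)"
      have v: "v \<in> C" "u \<noteq> v" "{x, y} \<subseteq> N u \<union> N v" using u v0 w by (auto simp: v_def)
      then have "card {x, y} \<le> card (N u \<union> N v)" using u finN by (intro card_mono) auto
      then show thesis using that u v y by auto
    qed
    have "t * real (card (N u \<union> N v)) \<ge> t * 2" using uv t by (intro mult_left_mono) auto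
    then have "real n < t * m + 2"
      using pair[OF uv(1-3)] by (simp add: n_def m_def algebra_simps)
    then have "n < 5" using tm by linarith
    then show False using m3 two by (simp add: m_def)
  next
    case False
    show False
    proof (cases "n \<ge> 4")
      case True
      \<comment> \<open>Since \<open>t \<le> 1\<close>, the common neighbours may be weighted by
        \<open>t\<close> instead of 1. This turns \<open>pair\<close> into a bound on a sum of two
        degrees, as \<open>sum_pairs_bound\<close> requires.\<close>
      have "t * card (N u) + t * card (N v) < 2 + 2 * t - (n - t * m)"
        if "u \<in> C" "v \<in> C" "u \<noteq> v" for u v
      proof -
        let ?a = "card (N u \<union> N v)" and ?c = "card (N u \<inter> N v)"
        have "t * card (N u) + t * card (N v) = t * real (card (N u) + card (N v))"
          by (simp add: algebra_simps)
        also have "\<dots> = t * ?a + t * ?c" using D that by (simp add: algebra_simps)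
        also have "\<dots> \<le> t * ?a + ?c"
          using \<open>\<not> t > 1\<close> mult_right_mono[of t 1 "real ?c"] by simp
        also have "\<dots> < 2 + 2 * t - (n - t * m)"
          using pair[OF that] by (simp add: algebra_simps n_def m_def)
        finally show ?thesis .
      qed
      then have "2 * (\<Sum>u\<in>C. t * card (N u)) < n * (2 + 2 * t - (n - t * m))"
        using sum_pairs_bound[OF finC, of "\<lambda>u. t * card (N u)"] n2 by (simp add: n_def)
      moreover have "(\<Sum>u\<in>C. t * card (N u)) \<ge> t * (2 * m)"
      proof -
        have "(\<Sum>x\<in>I. 2) \<le> (\<Sum>x\<in>I. card {u \<in> C. x \<in> N u})"
          using deg2 by (intro sum_mono) auto
        then have "2 * m \<le> (\<Sum>u\<in>C. card (N u))"
          using sum_card_incidence[OF finC finI sub] by (simp add: m_def mult.commute)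
        then have "real (2 * m) \<le> real (\<Sum>u\<in>C. card (N u))" by linarith
        then show ?thesis using t
          by (simp add: sum_distrib_left[symmetric] mult_left_mono)
      qed
      moreover have "real n * (2 * t) \<le> real n * 2" using \<open>\<not> t > 1\<close> by (intro mult_left_mono) auto
      \<comment> \<open>The two estimates of the degree sum give
        \<open>4 * t * m < n * (2 + 2 * t) - n * (n - t * m)\<close>, and
        \<open>2 + 2 * t \<le> 4\<close>.\<close>
      ultimately have "(n - t * m) * (real n - 4) < 0" by (simp add: algebra_simps)
      moreover have "(n - t * m) * (real n - 4) \<ge> 0"
        using tI True by (intro mult_nonneg_nonneg) (auto simp: n_def m_def)
      ultimately show False by simp
    next
      case False
      obtain u v where uv: "u \<in> C" "v \<in> C" "u \<noteq> v" "x \<in> N u" "x \<in> N v"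
        using deg2[OF x] card_le_Suc0_iff_eq[of "{u \<in> C. x \<in> N u}"] finC
        by (auto simp: numeral_2_eq_2 not_less_eq_eq[symmetric])
      have "card (C - {u, v}) = n - 2"
        using uv finC by (simp add: n_def card_Diff_subset)
      then have rest: "card (C - {u, v}) \<le> 1" using False by simp
      \<comment> \<open>At most one clique vertex lies outside \<open>{u, v}\<close>, while
        \<open>y\<close> has at least two neighbours.\<close>
      have hit: "y \<in> N u \<union> N v" if y: "y \<in> I" for y
      proof (rule ccontr)
        assume "y \<notin> N u \<union> N v"
        then have "card {u \<in> C. y \<in> N u} \<le> card (C - {u, v})"
          using finC by (intro card_mono) auto
        then show False using rest deg2[OF y] by simp
      qed
      then have "N u \<union> N v = I" using sub uv by blast
      then have le: "real n - 2 + card (N u \<inter> N v) < 2"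
        using pair[OF uv(1-3)] \<open>\<not> t > 1\<close> by (simp add: n_def)
      have c1: "card (N u \<inter> N v) \<ge> 1"
        using uv finN by (simp add: Suc_le_eq card_gt_0_iff) blast
      show False
      proof (cases "n = 2")
        case True
        then have Cuv: "C = {u, v}"
          using uv finC by (intro card_subset_eq[symmetric]) (auto simp: n_def)
        have "y \<in> N u \<inter> N v" if "y \<in> I" for y
        proof (rule ccontr)
          assume "y \<notin> N u \<inter> N v"
          then have "{w \<in> C. y \<in> N w} \<subseteq> {u} \<or> {w \<in> C. y \<in> N w} \<subseteq> {v}"
            using Cuv by auto
          then have "card {w \<in> C. y \<in> N w} \<le> 1"
            using card_mono[of "{u}" "{w \<in> C. y \<in> N w}"] card_mono[of "{v}" "{w \<in> C. y \<in> N w}"]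
            by (elim disjE) simp_all
        then show False using deg2[OF that] by simp
        qed
        \<comment> \<open>Two common neighbours contradict \<open>le\<close> for
          \<open>n = 2\<close>; for \<open>n = 3\<close> the single one from \<open>c1\<close>
          already does.\<close>
        then have "card I \<le> card (N u \<inter> N v)" using uv finN by (intro card_mono) auto
        then show False using le two n2 by simp
      next
        case False
        then show False using le c1 n2 by simp
      qed
    qed
  qed
qed

section \<open>Adjacency, components and the effect of deletions\<close>

lemma adj_sym: "adj G x y \<longleftrightarrow> adj G y x"
  by (simp add: adj_def insert_commute)

lemma not_adj_sym: "\<not> adj G x y \<Longrightarrow> \<not> adj G y x"
  by (simp add: adj_def insert_commute)

lemma adj_imp:
  assumes "simple_graph G" "adj G x y"
  shows "x \<in> verts G" "y \<in> verts G" "x \<noteq> y"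
proof -
  have "{x, y} \<subseteq> verts G" "card {x, y} = 2"
    using assms by (auto simp: simple_graph_def adj_def)
  then show "x \<in> verts G" "y \<in> verts G" "x \<noteq> y" by auto
qed

lemma edgeE:
  assumes "simple_graph G" "e \<in> edges G"
  obtains x y where "e = {x, y}" "x \<noteq> y" "adj G x y"
proof -
  have "card e = 2" using assms by (auto simp: simple_graph_def)
  then obtain x y where "e = {x, y}" "x \<noteq> y" by (auto simp: card_2_iff)
  with that assms show thesis by (auto simp: adj_def)
qed

lemma simple_graph_delete_edge: "simple_graph G \<Longrightarrow> simple_graph (delete_edge G e)"
  by (auto simp: simple_graph_def delete_edge_def)

lemma verts_delete_verts [simp]: "verts (delete_verts G S) = verts G - S"
  by (simp add: delete_verts_def)

lemma verts_delete_edge [simp]: "verts (delete_edge G e) = verts G"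
  by (simp add: delete_edge_def)

lemma adj_delete_verts: "adj (delete_verts G S) x y \<longleftrightarrow> adj G x y \<and> x \<notin> S \<and> y \<notin> S"
  by (auto simp: adj_def delete_verts_def)

lemma adj_delete_edge: "adj (delete_edge G e) x y \<longleftrightarrow> adj G x y \<and> {x, y} \<noteq> e"
  by (auto simp: adj_def delete_edge_def)

lemma delete_verts_delete_edge:
  "delete_verts (delete_edge G e) S = delete_edge (delete_verts G S) e"
  by (auto simp: delete_verts_def delete_edge_def)

lemma rtranclp_adj_sym: "(adj G)\<^sup>*\<^sup>* x y \<Longrightarrow> (adj G)\<^sup>*\<^sup>* y x"
  using adj_sym by (metis sympI symp_rtranclp sympD)

lemma equiv_connected_rel: "equiv (verts G) (connected_rel G)"
proof (rule equivI)
  show "refl_on (verts G) (connected_rel G)" by (auto simp: refl_on_def connected_rel_def)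
  show "sym (connected_rel G)" by (auto simp: sym_def connected_rel_def intro: rtranclp_adj_sym)
  show "trans (connected_rel G)" by (auto simp: trans_def connected_rel_def)
qed (auto simp: connected_rel_def)

lemma num_components_ge:
  assumes fin: "finite (verts G)" and X: "X \<subseteq> verts G"
    and sep: "\<And>x y. x \<in> X \<Longrightarrow> y \<in> X \<Longrightarrow> (adj G)\<^sup>*\<^sup>* x y \<Longrightarrow> x = y"
  shows "card X \<le> num_components G"
proof -
  let ?f = "\<lambda>x. connected_rel G `` {x}"
  have "inj_on ?f X"
  proof (rule inj_onI)
    fix x y assume xy: "x \<in> X" "y \<in> X" "?f x = ?f y"
    then have "(x, y) \<in> connected_rel G"
      using equiv_connected_rel X by (metis eq_equiv_class subsetD)
    then show "x = y" using sep xy by (auto simp: connected_rel_def)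
  qed
  then have "card X = card (?f ` X)" by (simp add: card_image)
  also have "\<dots> \<le> card (graph_components G)"
    using fin X by (intro card_mono) (auto simp: graph_components_def quotient_def)
  finally show ?thesis by (simp add: num_components_def)
qed

lemma num_components_le:
  assumes R: "finite R" "R \<subseteq> verts G"
    and reach: "\<And>x. x \<in> verts G \<Longrightarrow> \<exists>r\<in>R. (adj G)\<^sup>*\<^sup>* r x"
  shows "num_components G \<le> card R"
proof -
  let ?f = "\<lambda>x. connected_rel G `` {x}"
  have "graph_components G \<subseteq> ?f ` R"
  proof
    fix K assume "K \<in> graph_components G"
    then obtain x where x: "x \<in> verts G" "K = ?f x"
      by (auto simp: graph_components_def quotient_def)
    obtain r where r: "r \<in> R" "(adj G)\<^sup>*\<^sup>* r x" using reach x by blast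
    then have "(r, x) \<in> connected_rel G" using R x by (auto simp: connected_rel_def)
    then have "?f r = ?f x" using equiv_connected_rel by (metis equiv_class_eq)
    then show "K \<in> ?f ` R" using r x by blast
  qed
  then have "card (graph_components G) \<le> card (?f ` R)"
    using R by (intro card_mono) auto
  also have "\<dots> \<le> card R" using R by (intro card_image_le)
  finally show ?thesis by (simp add: num_components_def)
qed

text \<open>An edge that is not a bridge can be replaced in every walk by a detour, so reachability
  does not change.\<close>

lemma num_components_delete_edge:
  assumes "(adj (delete_edge G {u, v}))\<^sup>*\<^sup>* u v"
  shows "num_components (delete_edge G {u, v}) = num_components G"
proof -
  let ?H = "delete_edge G {u, v}"
  have step: "(adj ?H)\<^sup>*\<^sup>* x y" if "adj G x y" for x y
  proof (cases "{x, y} = {u, v}")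
    case True
    then have "x = u \<and> y = v \<or> x = v \<and> y = u" by (auto simp: doubleton_eq_iff)
    then show ?thesis using assms rtranclp_adj_sym[OF assms] by auto
  next
    case False
    then have "adj ?H x y" using that by (simp add: adj_delete_edge)
    then show ?thesis by (rule r_into_rtranclp)
  qed
  have "(adj G)\<^sup>*\<^sup>* x y \<longleftrightarrow> (adj ?H)\<^sup>*\<^sup>* x y" for x y
  proof
    show "(adj ?H)\<^sup>*\<^sup>* x y" if "(adj G)\<^sup>*\<^sup>* x y"
      using that by (induction rule: rtranclp_induct) (blast, meson step rtranclp_trans)
    show "(adj G)\<^sup>*\<^sup>* x y" if "(adj ?H)\<^sup>*\<^sup>* x y"
      using that by (rule mono_rtranclp[rule_format, rotated]) (simp add: adj_delete_edge)
  qed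
  then show ?thesis
    by (simp add: num_components_def graph_components_def connected_rel_def)
qed

text \<open>Replaces the extended real \<open>toughness\<close> by the predicate
  \<open>tough\<close>. The value is finite, which rules out complete graphs, both for
  \<open>G\<close> and after deleting an edge, so the greatest element is attained.\<close>

lemma minimally_toughD:
  assumes G: "simple_graph G" and mt: "minimally_tough G t"
  shows "\<not> complete_graph G" "tough G t" "e \<in> edges G \<Longrightarrow> \<not> tough (delete_edge G e) t"
proof -
  show nc: "\<not> complete_graph G" using mt by (auto simp: minimally_tough_def toughness_def)
  then have "(GREATEST t. tough G t) = t"
    using mt by (auto simp: minimally_tough_def toughness_def)
  then show "tough G t" using tough_Greatest(1)[OF G nc] by simp
  assume "e \<in> edges G"
  then have "toughness (delete_edge G e) < ereal t" using mt by (auto simp: minimally_tough_def)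
  then have "\<not> complete_graph (delete_edge G e)" "(GREATEST t. tough (delete_edge G e) t) < t"
    by (auto simp: toughness_def split: if_splits)
  then show "\<not> tough (delete_edge G e) t"
    using tough_Greatest(2)[OF simple_graph_delete_edge[OF G], of e t] by fastforce
qed

section \<open>Split graphs are not minimally tough\<close>

definition clique :: "'a graph \<Rightarrow> 'a set \<Rightarrow> bool" where
  "clique G C \<longleftrightarrow> C \<subseteq> verts G \<and> (\<forall>x\<in>C. \<forall>y\<in>C. x \<noteq> y \<longrightarrow> adj G x y)"

definition split_partition :: "'a graph \<Rightarrow> 'a set \<Rightarrow> 'a set \<Rightarrow> bool" where
  "split_partition G C I \<longleftrightarrow> C \<union> I = verts G \<and> C \<inter> I = {} \<and> clique G C \<and>
     (\<forall>x\<in>I. \<forall>y\<in>I. \<not> adj G x y)"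

lemma split_graph_not_minimally_tough:
  assumes G: "simple_graph G" and split: "split_partition G C I"
    and t: "t > 1 / 2"
    and ne: "\<And>u. u \<in> C \<Longrightarrow> \<exists>x\<in>I. adj G u x"
  shows "\<not> minimally_tough G t"
proof
  assume mt: "minimally_tough G t"
  note nc = minimally_toughD(1)[OF G mt] and tough = minimally_toughD(2)[OF G mt]
    and crit = minimally_toughD(3)[OF G mt]
  define N where "N u = {x \<in> I. adj G u x}" for u
  have V: "verts G = C \<union> I" "C \<inter> I = {}" and K: "\<And>x y. x \<in> C \<Longrightarrow> y \<in> C \<Longrightarrow> x \<noteq> y \<Longrightarrow> adj G x y"
    and ind: "\<And>x y. x \<in> I \<Longrightarrow> y \<in> I \<Longrightarrow> \<not> adj G x y"
    using split by (auto simp: split_partition_def clique_def)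
  have fin: "finite C" "finite I" using G V by (auto simp: simple_graph_def)
  \<comment> \<open>Toughness in a usable form: vertices in pairwise different components of
    \<open>G - S\<close> bound the number of components from below, and \<open>t\<close> is
    positive.\<close>
  have tough': "t * card X \<le> card S"
    if "S \<subseteq> verts G" "X \<subseteq> verts G - S" "card X \<ge> 2"
      "\<And>x y. x \<in> X \<Longrightarrow> y \<in> X \<Longrightarrow> (adj (delete_verts G S))\<^sup>*\<^sup>* x y \<Longrightarrow> x = y" for S X
  proof -
    have le: "card X \<le> num_components (delete_verts G S)"
      using that fin V by (intro num_components_ge) auto
    then have "t * num_components (delete_verts G S) \<le> card S"
      using tough that by (auto simp: tough_def)
    moreover have "t * card X \<le> t * num_components (delete_verts G S)"
      using le t by (intro mult_left_mono) auto
    ultimately show ?thesis by linarith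
  qed
  \<comment> \<open>With at most one vertex in \<open>I\<close>, \<open>ne\<close> joins it to all
    of \<open>C\<close>, so \<open>G\<close> would be complete.\<close>
  have two: "card I \<ge> 2"
  proof (rule ccontr)
    assume "\<not> card I \<ge> 2"
    then have le: "card I \<le> Suc 0" by simp
    have one: "x = y" if "x \<in> I" "y \<in> I" for x y
      using le card_le_Suc0_iff_eq[OF fin(2)] that by blast
    have CI: "adj G u x" if "u \<in> C" "x \<in> I" for u x
      using ne[OF that(1)] one[OF that(2)] by auto
    have "complete_graph G" unfolding complete_graph_def
    proof (intro ballI impI)
      fix a b assume "a \<in> verts G" "b \<in> verts G" "a \<noteq> b"
      then consider "a \<in> C" "b \<in> C" | "a \<in> C" "b \<in> I" | "a \<in> I" "b \<in> C"
        using V one by blast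
      then show "adj G a b"
        using K CI \<open>a \<noteq> b\<close> adj_sym[of G a b] by cases auto
    qed
    then show False using nc by simp
  qed
  show False
  proof (rule split_counting[of C I N t])
    show "t * card I \<le> card C"
    proof (rule tough')
      show "x = y" if "(adj (delete_verts G C))\<^sup>*\<^sup>* x y" for x y
        using that
      proof (cases rule: converse_rtranclpE)
        case (step z)
        then have "x \<in> I" "z \<in> I" "adj G x z"
          using adj_imp[OF G] V by (auto simp: adj_delete_verts)
        then show ?thesis using ind by blast
      qed
    qed (use V two in auto)
    show "2 * t \<le> card {u \<in> C. x \<in> N u}" if x: "x \<in> I" for x
    proof -
      let ?S = "{u \<in> C. x \<in> N u}"
      have iso: "a = x" if "(adj (delete_verts G ?S))\<^sup>*\<^sup>* x a" for a
        using that
      proof (cases rule: converse_rtranclpE)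
        case (step z)
        then have a: "adj G x z" "z \<notin> ?S" by (auto simp: adj_delete_verts)
        then have "z \<in> C" using ind[OF x] adj_imp[OF G] V by blast
        then show ?thesis using a x adj_sym[of G x z] by (auto simp: N_def)
      qed auto
      obtain y where y: "y \<in> I" "y \<noteq> x"
        using two x fin by (metis card_le_Suc0_iff_eq not_less_eq_eq numeral_2_eq_2)
      \<comment> \<open>Deleting the neighbourhood of \<open>x\<close> isolates \<open>x\<close>,
        and \<open>y\<close> survives because only vertices of \<open>C\<close> are deleted.\<close>
      have "t * card {x, y} \<le> card ?S"
      proof (rule tough')
        show "a = b" if "a \<in> {x, y}" "b \<in> {x, y}" "(adj (delete_verts G ?S))\<^sup>*\<^sup>* a b" for a b
          using that(1,2) that(3) rtranclp_adj_sym[OF that(3)] iso[of a] iso[of b] by auto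
        show "?S \<subseteq> verts G" using V by blast
        show "{x, y} \<subseteq> verts G - ?S" using x y V by blast
        show "card {x, y} \<ge> 2" using y by simp
      qed
      then show ?thesis using y by (simp add: mult.commute)
    qed
    show "real (card C) - 2 + card (N u \<inter> N v) < t * (2 + real (card I) - card (N u \<union> N v))"
      if uv: "u \<in> C" "v \<in> C" "u \<noteq> v" for u v
    proof -
      have "\<not> tough (delete_edge G {u, v}) t"
        using crit K uv by (auto simp: adj_def)
      then obtain S where S: "S \<subseteq> verts G"
        "num_components (delete_verts (delete_edge G {u, v}) S) > 1"
        "card S < t * num_components (delete_verts (delete_edge G {u, v}) S)"
        by (auto simp: tough_def not_le)
      define H where "H = delete_verts (delete_edge G {u, v}) S"
      have H': "H = delete_edge (delete_verts G S) {u, v}"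
        by (simp add: H_def delete_verts_delete_edge)
      have adjH: "adj H x y \<longleftrightarrow> adj G x y \<and> x \<notin> S \<and> y \<notin> S \<and> {x, y} \<noteq> {u, v}" for x y
        by (auto simp: H_def adj_delete_verts adj_delete_edge)
      have VH: "verts H = verts G - S" by (simp add: H_def)
      \<comment> \<open>Otherwise \<open>S\<close> would already violate the toughness of
        \<open>G\<close>. Hence \<open>uv\<close> is a bridge of \<open>G - S\<close>: its ends
        avoid \<open>S\<close>, and no path joins them in \<open>H\<close>.\<close>
      have neq: "num_components H \<noteq> num_components (delete_verts G S)"
      proof
        assume "num_components H = num_components (delete_verts G S)"
        then have "t * num_components H \<le> card S"
          using S(1,2) tough by (simp add: H_def tough_def)
        then show False using S(3) by (simp add: H_def)
      qed
      have nuv: "\<not> (adj H)\<^sup>*\<^sup>* u v"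
        using neq num_components_delete_edge unfolding H' by metis
      have uvS: "u \<notin> S" "v \<notin> S"
      proof -
        have "delete_edge (delete_verts G S) {u, v} = delete_verts G S" if "u \<in> S \<or> v \<in> S"
          using that by (auto simp: delete_edge_def delete_verts_def)
        then show "u \<notin> S" "v \<notin> S" using neq H' by auto
      qed
      have common: "w \<in> S" if "adj G u w" "adj G v w" for w
      proof (rule ccontr)
        assume "w \<notin> S"
        moreover have "w \<noteq> u" "w \<noteq> v" using that adj_imp[OF G] by blast+
        ultimately have "adj H u w" "adj H w v"
          using that uvS adj_sym[of G v w] by (auto simp: adjH doubleton_eq_iff)
        then show False using nuv by (meson converse_rtranclp_into_rtranclp r_into_rtranclp)
      qed
      have "(C - {u, v}) \<union> (N u \<inter> N v) \<subseteq> S"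
        using common K uv by (auto simp: N_def)
      then have "card ((C - {u, v}) \<union> (N u \<inter> N v)) \<le> card S"
        using S(1) fin V by (intro card_mono) (auto intro: finite_subset)
      also have "card ((C - {u, v}) \<union> (N u \<inter> N v)) = card (C - {u, v}) + card (N u \<inter> N v)"
        using fin V by (intro card_Un_disjoint) (auto simp: N_def)
      finally have "card (C - {u, v}) + card (N u \<inter> N v) \<le> card S" .
      moreover have "card (C - {u, v}) = card C - 2"
        using uv fin by (simp add: card_Diff_subset)
      moreover have "card C \<ge> 2" using card_mono[OF fin(1), of "{u, v}"] uv by auto
      ultimately have lower: "real (card C) - 2 + card (N u \<inter> N v) \<le> card S" by linarith
      \<comment> \<open>Representatives of the components of \<open>H\<close>: the only clique
        vertices left are \<open>u\<close> and \<open>v\<close>, and every other surviving vertex is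
        adjacent to one of them or belongs to \<open>?R\<close>.\<close>
      let ?R = "{u, v} \<union> (I - S - (N u \<union> N v))"
      have "num_components H \<le> card ?R"
      proof (rule num_components_le)
        show "?R \<subseteq> verts H" using uv uvS V by (auto simp: VH)
        fix x assume x: "x \<in> verts H"
        show "\<exists>r\<in>?R. (adj H)\<^sup>*\<^sup>* r x"
        proof (cases "x \<in> ?R")
          case False
          then have "x \<in> N u \<union> N v"
            using x V \<open>(C - {u, v}) \<union> (N u \<inter> N v) \<subseteq> S\<close> by (auto simp: VH)
          moreover have "x \<noteq> u" "x \<noteq> v" using False by auto
          ultimately have "adj H u x \<or> adj H v x"
            using uvS x by (auto simp: adjH VH N_def doubleton_eq_iff)
          then show ?thesis by blast
        qed blast
      qed (use fin in auto)
      also have "card ?R \<le> card {u, v} + card (I - S - (N u \<union> N v))" by (rule card_Un_le)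
      also have "\<dots> \<le> 2 + card (I - (N u \<union> N v))"
        using uv fin by (intro add_mono card_mono) auto
      also have "card (I - (N u \<union> N v)) = card I - card (N u \<union> N v)"
        using fin by (intro card_Diff_subset) (auto simp: N_def)
      finally have "num_components H \<le> 2 + (card I - card (N u \<union> N v))" .
      moreover have "card (N u \<union> N v) \<le> card I"
        using fin by (intro card_mono) (auto simp: N_def)
      ultimately have "real (num_components H) \<le> 2 + real (card I) - card (N u \<union> N v)"
        by linarith
      then have "t * num_components H \<le> t * (2 + real (card I) - card (N u \<union> N v))"
        using t by (intro mult_left_mono) auto
      then show ?thesis using S(3) lower by (simp add: H_def)
    qed
  qed (use fin ne two t in \<open>auto simp: N_def\<close>)
qed

text \<open>Moving a single vertex \<open>u\<close> suffices: once it lies in the independent set,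
  every remaining clique vertex has \<open>u\<close> as a neighbour there.\<close>

lemma split_partition_maximal_independent:
  assumes G: "simple_graph G" and split: "split_partition G C I"
  obtains C' I' where "split_partition G C' I'" "\<And>u. u \<in> C' \<Longrightarrow> \<exists>x\<in>I'. adj G u x"
proof (cases "\<exists>u\<in>C. \<forall>x\<in>I. \<not> adj G u x")
  case False
  then show thesis using that[OF split] by blast
next
  case True
  then obtain u where u: "u \<in> C" "\<forall>x\<in>I. \<not> adj G u x" by blast
  have "\<not> adj G u u" using adj_imp[OF G] by blast
  show thesis
  proof (rule that)
    show "split_partition G (C - {u}) (insert u I)"
      unfolding split_partition_def
    proof (intro conjI ballI)
      show "C - {u} \<union> insert u I = verts G" "(C - {u}) \<inter> insert u I = {}" "clique G (C - {u})"
        using split u by (auto simp: split_partition_def clique_def)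
      show "\<not> adj G x y" if "x \<in> insert u I" "y \<in> insert u I" for x y
      proof -
        have "x \<in> I \<and> y \<in> I \<or> x = u \<or> y = u" using that by blast
        then show ?thesis
          using that split u \<open>\<not> adj G u u\<close> adj_sym[of G x y]
          by (auto simp: split_partition_def)
      qed
    qed
    show "\<exists>x\<in>insert u I. adj G v x" if "v \<in> C - {u}" for v
      using split u that by (auto simp: split_partition_def clique_def)
  qed
qed

section \<open>Recognising the three induced subgraphs\<close>

lemma contains_induced_listI:
  assumes V: "verts H = {..<length xs}" and d: "distinct xs" and sub: "set xs \<subseteq> verts G"
    and a: "\<And>i j. i < length xs \<Longrightarrow> j < length xs \<Longrightarrow> adj H i j \<longleftrightarrow> adj G (xs ! i) (xs ! j)"
  shows "contains_induced G H"
  unfolding contains_induced_def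
proof (intro exI[of _ "(!) xs"] conjI)
  show "inj_on ((!) xs) (verts H)" using d by (simp add: V inj_on_nth)
  show "(!) xs ` verts H \<subseteq> verts G" using sub by (auto simp: V)
qed (use a in \<open>auto simp: V\<close>)

text \<open>The adjacency conditions alone would allow \<open>a = c\<close> or \<open>b = d\<close>,
  so \<open>ne\<close> excludes these. For the 5-cycle and for \<open>two_K2\<close> the adjacency
  pattern itself separates all vertices.\<close>

lemma contains_induced_C4:
  assumes G: "simple_graph G"
    and a: "adj G a b" "adj G b c" "adj G c d" "adj G d a"
    and ne: "a \<noteq> c" "b \<noteq> d" and n: "\<not> adj G a c" "\<not> adj G b d"
  shows "contains_induced G (cycle_graph 4)"
proof (rule contains_induced_listI[of _ "[a, b, c, d]"])
  have irr: "\<not> adj G x x" for x using adj_imp(3)[OF G] by blast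
  note a' = a[THEN adj_sym[THEN iffD1]] and n' = n[THEN not_adj_sym]
  have E: "edges (cycle_graph 4) = {{0, 1}, {1, 2}, {2, 3}, {3, 0}}"
  proof -
    have "edges (cycle_graph 4) = (\<lambda>i. {i, Suc i mod 4}) ` {..<4}"
      by (auto simp: cycle_graph_def)
    also have "{..<4} = {0, 1, 2, 3::nat}" by auto
    finally show ?thesis by simp (simp add: numeral_2_eq_2)
  qed
  show "adj (cycle_graph 4) i j \<longleftrightarrow> adj G ([a, b, c, d] ! i) ([a, b, c, d] ! j)"
    if "i < length [a, b, c, d]" "j < length [a, b, c, d]" for i j
  proof -
    have "i \<in> {0, 1, 2, 3}" "j \<in> {0, 1, 2, 3}" using that by auto
    then show ?thesis
      unfolding adj_def[of "cycle_graph 4"] E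
      by (elim insertE emptyE) (simp_all add: a n a' n' irr doubleton_eq_iff)
  qed
  show "distinct [a, b, c, d]" using a ne irr by auto
  show "set [a, b, c, d] \<subseteq> verts G" using a adj_imp[OF G] by simp
qed (auto simp: cycle_graph_def)

lemma contains_induced_C5:
  assumes G: "simple_graph G"
    and a: "adj G a b" "adj G b c" "adj G c d" "adj G d e" "adj G e a"
    and n: "\<not> adj G a c" "\<not> adj G a d" "\<not> adj G b d" "\<not> adj G b e" "\<not> adj G c e"
  shows "contains_induced G (cycle_graph 5)"
proof (rule contains_induced_listI[of _ "[a, b, c, d, e]"])
  have irr: "\<not> adj G x x" for x using adj_imp(3)[OF G] by blast
  note a' = a[THEN adj_sym[THEN iffD1]] and n' = n[THEN not_adj_sym]
  have E: "edges (cycle_graph 5) = {{0, 1}, {1, 2}, {2, 3}, {3, 4}, {4, 0}}"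
  proof -
    have "edges (cycle_graph 5) = (\<lambda>i. {i, Suc i mod 5}) ` {..<5}"
      by (auto simp: cycle_graph_def)
    also have "{..<5} = {0, 1, 2, 3, 4::nat}" by auto
    finally show ?thesis by simp (simp add: numeral_2_eq_2)
  qed
  show "adj (cycle_graph 5) i j \<longleftrightarrow> adj G ([a, b, c, d, e] ! i) ([a, b, c, d, e] ! j)"
    if "i < length [a, b, c, d, e]" "j < length [a, b, c, d, e]" for i j
  proof -
    have "i \<in> {0, 1, 2, 3, 4}" "j \<in> {0, 1, 2, 3, 4}" using that by auto
    then show ?thesis
      unfolding adj_def[of "cycle_graph 5"] E
      by (elim insertE emptyE) (simp_all add: a n a' n' irr doubleton_eq_iff)
  qed
  show "distinct [a, b, c, d, e]" using a n a' n' irr by auto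
  show "set [a, b, c, d, e] \<subseteq> verts G" using a adj_imp[OF G] by simp
qed (auto simp: cycle_graph_def)

lemma contains_induced_two_K2:
  assumes G: "simple_graph G"
    and a: "adj G a b" "adj G c d"
    and n: "\<not> adj G a c" "\<not> adj G a d" "\<not> adj G b c" "\<not> adj G b d"
  shows "contains_induced G two_K2"
proof (rule contains_induced_listI[of _ "[a, b, c, d]"])
  have irr: "\<not> adj G x x" for x using adj_imp(3)[OF G] by blast
  note a' = a[THEN adj_sym[THEN iffD1]] and n' = n[THEN not_adj_sym]
  have E: "edges two_K2 = {{0, 1}, {2, 3}}" by (simp add: two_K2_def)
  show "adj two_K2 i j \<longleftrightarrow> adj G ([a, b, c, d] ! i) ([a, b, c, d] ! j)"
    if "i < length [a, b, c, d]" "j < length [a, b, c, d]" for i j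
  proof -
    have "i \<in> {0, 1, 2, 3}" "j \<in> {0, 1, 2, 3}" using that by auto
    then show ?thesis
      unfolding adj_def[of two_K2] E
      by (elim insertE emptyE) (simp_all add: a n a' n' irr doubleton_eq_iff)
  qed
  show "distinct [a, b, c, d]" using a n a' n' irr by auto
  show "set [a, b, c, d] \<subseteq> verts G" using a adj_imp[OF G] by simp
qed (auto simp: two_K2_def)

section \<open>The theorem of Foeldes and Hammer on split graphs\<close>

text \<open>Suppose an edge \<open>xy\<close> avoids the extremal clique \<open>C\<close>. The sets
  of non-neighbours of \<open>x\<close> and \<open>y\<close> in \<open>C\<close> are nonempty,
  nested (no 4-cycle) and share at most one vertex (no \<open>two_K2\<close>), so the smaller one is
  a singleton. Exchanging its vertex for the corresponding end of the edge then produces an induced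
  5-cycle.\<close>

lemma split_partition_exists:
  assumes G: "simple_graph G"
    and C4: "\<not> contains_induced G (cycle_graph 4)" and C5: "\<not> contains_induced G (cycle_graph 5)"
    and K2: "\<not> contains_induced G two_K2"
  obtains C I where "split_partition G C I"
proof -
  define E where "E C = {e \<in> edges G. e \<inter> C = {}}" for C
  have finV: "finite (verts G)" using G by (simp add: simple_graph_def)
  have "edges G \<subseteq> Pow (verts G)" using G by (auto simp: simple_graph_def)
  then have finE: "finite (edges G)" using finV finite_subset by blast
  \<comment> \<open>The clique is of maximum size and, among those, has as few edges as possible avoiding it.\<close>
  have "clique G {}" by (simp add: clique_def)
  moreover have "card D < Suc (card (verts G))" if "clique G D" for D
    using that finV by (simp add: clique_def card_mono less_Suc_eq_le)
  ultimately obtain C0 where C0: "clique G C0" "\<And>D. clique G D \<Longrightarrow> card D \<le> card C0"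
    using ex_has_greatest_nat[of "clique G" "{}" card] by blast
  obtain C where C: "clique G C" "card C = card C0"
    "\<And>D. clique G D \<Longrightarrow> card D = card C0 \<Longrightarrow> card (E C) \<le> card (E D)"
    using ex_has_least_nat[of "\<lambda>D. clique G D \<and> card D = card C0" C0 "\<lambda>D. card (E D)"] C0(1) by auto
  have CV: "C \<subseteq> verts G" and K: "\<And>x y. x \<in> C \<Longrightarrow> y \<in> C \<Longrightarrow> x \<noteq> y \<Longrightarrow> adj G x y"
    using C(1) by (auto simp: clique_def)
  have finC: "finite C" using CV finV finite_subset by blast
  define nb where "nb x = {u \<in> C. \<not> adj G x u}" for x
  have nb_ne: "nb x \<noteq> {}" if x: "x \<in> verts G" "x \<notin> C" for x
  proof
    assume "nb x = {}"
    then have "adj G x u" "adj G u x" if "u \<in> C" for u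
      using that adj_sym[of G x u] by (auto simp: nb_def)
    then have "clique G (insert x C)"
      using x CV K by (auto simp: clique_def)
    then have "card (insert x C) \<le> card C" using C0(2) C(2) by simp
    then show False using x finC by simp
  qed
  \<comment> \<open>Otherwise \<open>x\<close>, \<open>y\<close>, \<open>u\<close>, \<open>v\<close>
    in this order form an induced 4-cycle.\<close>
  have nb_nested: "u \<in> nb y \<or> v \<in> nb x"
    if xy: "adj G x y" "x \<notin> C" "y \<notin> C" and u: "u \<in> nb x" and v: "v \<in> nb y" for x y u v
  proof (rule ccontr)
    assume neg: "\<not> ?thesis"
    then have "u \<noteq> v" using u v by auto
    then have "adj G y u" "adj G u v" "adj G v x"
      using neg u v K adj_sym[of G v x] by (auto simp: nb_def)
    then have "contains_induced G (cycle_graph 4)"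
      using xy u v by (intro contains_induced_C4[OF G, of x y u v]) (auto simp: nb_def)
    then show False using C4 by simp
  qed
  have nb_common: "u = v"
    if xy: "adj G x y" and uv: "u \<in> nb x \<inter> nb y" "v \<in> nb x \<inter> nb y" for x y u v
  proof (rule ccontr)
    assume "u \<noteq> v"
    then have "contains_induced G two_K2"
      using xy uv K by (intro contains_induced_two_K2[OF G, of x y u v]) (auto simp: nb_def)
    then show False using K2 by simp
  qed
  have step: False
    if xy: "adj G x y" "x \<notin> C" "y \<notin> C" and nbx: "nb x = {u}" and uy: "u \<in> nb y" for x y u
  proof -
    have V: "x \<in> verts G" "y \<in> verts G" "x \<noteq> y" using adj_imp[OF G xy(1)] by auto
    have u: "u \<in> C" "\<not> adj G x u" "\<not> adj G y u" using nbx uy by (auto simp: nb_def)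
    have xC: "adj G x v" "adj G v x" if "v \<in> C" "v \<noteq> u" for v
      using nbx that adj_sym[of G v x] by (auto simp: nb_def)
    define C' where "C' = insert x (C - {u})"
    define Z where "Z = {z. z \<notin> C \<and> z \<noteq> x \<and> adj G u z}"
    have "clique G C'" using V(1) CV K xC by (auto simp: clique_def C'_def)
    moreover have "card C' = card C0"
      using finC u(1) xy(2) C(2) card_Suc_Diff1[of C u] by (simp add: C'_def)
    ultimately have EC: "card (E C) \<le> card (E C')" using C(3) by blast
    \<comment> \<open>The exchanged clique \<open>C'\<close> is also of maximum size. Beyond the
      edges in \<open>F\<close>, those avoiding \<open>C'\<close> join \<open>u\<close> to
      \<open>Z\<close>, whereas those avoiding \<open>C\<close> include all edges from
      \<open>x\<close> to vertices outside \<open>C\<close>. If \<open>x\<close> were adjacent to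
      all of \<open>Z\<close>, the extra edge \<open>xy\<close> would make \<open>C'\<close>
      strictly better than \<open>C\<close>.\<close>
    have "\<exists>z\<in>Z. \<not> adj G x z"
    proof (rule ccontr)
      assume "\<not> ?thesis"
      then have Zx: "adj G x z" if "z \<in> Z" for z using that by blast
      define F where "F = {e \<in> edges G. e \<inter> insert x C = {}}"
      have "Z \<subseteq> verts G" using adj_imp[OF G] by (auto simp: Z_def)
      then have fin: "finite Z" "finite F" using finV finE finite_subset by (auto simp: F_def)
      have "y \<notin> Z" using u(3) adj_sym[of G u y] by (simp add: Z_def)
      have "E C' \<subseteq> F \<union> (\<lambda>z. {u, z}) ` Z"
      proof
        fix e assume e: "e \<in> E C'"
        show "e \<in> F \<union> (\<lambda>z. {u, z}) ` Z"
        proof (cases "u \<in> e")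
          case False
          then show ?thesis using e by (auto simp: E_def F_def C'_def)
        next
          case True
          obtain a b where ab: "e = {a, b}" "a \<noteq> b" "adj G a b"
            using edgeE[OF G] e by (auto simp: E_def)
          obtain z where z: "e = {u, z}" "z \<noteq> u" "adj G u z"
            using True ab adj_sym[of G a b] by (cases "u = a") auto
          then have "z \<in> Z" using e by (auto simp: E_def C'_def Z_def)
          then show ?thesis using z by blast
        qed
      qed
      then have "card (E C') \<le> card (F \<union> (\<lambda>z. {u, z}) ` Z)"
        using fin by (intro card_mono) auto
      also have "\<dots> \<le> card F + card ((\<lambda>z. {u, z}) ` Z)" by (rule card_Un_le)
      also have "\<dots> \<le> card F + card Z" using fin by (simp add: card_image_le)
      also have "\<dots> < card F + card (insert y Z)" using fin \<open>y \<notin> Z\<close> by simp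
      also have "card (insert y Z) = card ((\<lambda>z. {x, z}) ` insert y Z)"
        by (intro card_image[symmetric] inj_onI) (auto simp: doubleton_eq_iff)
      also have "card F + \<dots> = card (F \<union> (\<lambda>z. {x, z}) ` insert y Z)"
        using fin by (intro card_Un_disjoint[symmetric]) (auto simp: F_def)
      also have "\<dots> \<le> card (E C)"
        using finE xy Zx by (intro card_mono) (auto simp: E_def F_def Z_def adj_def)
      finally show False using EC by simp
    qed
    then obtain z where z: "z \<notin> C" "z \<noteq> x" "adj G u z" "\<not> adj G x z"
      by (auto simp: Z_def)
    have zV: "z \<in> verts G" using z(3) adj_imp[OF G] by blast
    \<comment> \<open>Otherwise the edges \<open>xy\<close> and \<open>zu\<close> induce
      \<open>two_K2\<close>.\<close>
    have yz: "adj G y z"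
    proof (rule ccontr)
      assume "\<not> adj G y z"
      then show False
        using K2 contains_induced_two_K2[OF G xy(1), of z u] z u adj_sym[of G z u] by simp
    qed
    obtain w where w: "w \<in> nb z" using nb_ne[OF zV z(1)] by blast
    have "u \<notin> nb z" using z(3) adj_sym[of G z u] by (simp add: nb_def)
    \<comment> \<open>Nestedness is now applied to the edge \<open>yz\<close>: \<open>u\<close> is
      missed by \<open>y\<close> but not by \<open>z\<close>, so \<open>w\<close>, missed by
      \<open>z\<close>, is also missed by \<open>y\<close>. This closes the 5-cycle
      \<open>x\<close>, \<open>y\<close>, \<open>z\<close>, \<open>u\<close>,
      \<open>w\<close>.\<close>
    then have "w \<in> nb y" "w \<noteq> u" using nb_nested[OF yz xy(3) z(1) uy w] w by auto
    then have "w \<in> C" "\<not> adj G y w" "\<not> adj G z w" "adj G u w" "adj G w x"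
      using w K u(1) xC by (auto simp: nb_def)
    then have "contains_induced G (cycle_graph 5)"
      using xy(1) yz z u adj_sym[of G z u] by (intro contains_induced_C5[OF G, of x y z u w]) auto
    then show False using C5 by simp
  qed
  have "\<not> adj G x y" if xyV: "x \<in> verts G - C" "y \<in> verts G - C" for x y
  proof
    assume xy: "adj G x y"
    have yx: "adj G y x" using xy adj_sym[of G x y] by simp
    obtain u v where u: "u \<in> nb x" and v: "v \<in> nb y"
      using nb_ne[of x] nb_ne[of y] xyV by blast
    consider "nb x \<subseteq> nb y" | "nb y \<subseteq> nb x"
      using nb_nested[OF xy] xyV by blast
    then show False
    proof cases
      case 1
      then have "nb x = {u}" using u nb_common[OF xy] by blast
      then show False using step[OF xy, of u] xyV u 1 by blast
    next
      case 2
      then have "nb y = {v}" using v nb_common[OF xy] by blast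
      then show False using step[OF yx, of v] xyV v 2 by blast
    qed
  qed
  then have "split_partition G C (verts G - C)"
    using C(1) CV by (auto simp: split_partition_def)
  then show thesis by (rule that)
qed

theorem corollary4p10:
  fixes G :: "'a graph" and t :: real
  assumes "simple_graph G"
    and "t \<in> \<rat>" and "t > 1 / 2"
    and "minimally_tough G t"
  shows "contains_induced G (cycle_graph 4) \<or> contains_induced G (cycle_graph 5) \<or>
    contains_induced G two_K2"
proof (rule ccontr)
  assume "\<not> ?thesis"
  then obtain C0 I0 where "split_partition G C0 I0"
    using split_partition_exists[OF assms(1)] by blast
  then obtain C I where "split_partition G C I" "\<And>u. u \<in> C \<Longrightarrow> \<exists>x\<in>I. adj G u x"
    using split_partition_maximal_independent[OF assms(1)] by blast
  then show False
    using split_graph_not_minimally_tough[OF assms(1)] assms(3,4) by blast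
qed

end
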